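(* Let $A$ be an $n\times n$ complex EP matrix, $X$ an $n\times p$ complex matrix, $Y$ an $n\times q$ complex matrix, and let $$M = A^{\dagger} - A^{\dagger} X (Y^{*} A^{\dagger} X)^{\dagger} Y^{*} A^{\dagger}.$$ Put $\mathcal A=\operatorname{im}(A)$, $\hat{\mathcal X}=\ker(M)$, $\hat{\mathcal Y}=\operatorname{im}(M)^{\perp}$, $\hat{\mathcal X}_{\mathcal A}=\hat{\mathcal X}\cap\mathcal A$ and $\hat{\mathcal Y}_{\mathcal A}=\hat{\mathcal Y}\cap\mathcal A$. Suppose $\operatorname{ind}(M)=1$. Let $U_{\hat{\mathcal X}_{\mathcal A}},U_{\hat{\mathcal Y}_{\mathcal A}},U_{\hat{\mathcal X}^{\perp}},U_{\hat{\mathcal Y}^{\perp}}$ be matrices with orthonormal columns forming bases of $\hat{\mathcal X}_{\mathcal A},\hat{\mathcal Y}_{\mathcal A},\hat{\mathcal X}^{\perp},\hat{\mathcal Y}^{\perp}$, respectively. Then $$|M|_{\dagger}=\frac{|U_{\hat{\mathcal X}^{\perp}}^{*}U_{\hat{\mathcal Y}^{\perp}}|}{|U_{\hat{\mathcal X}^{\perp}}^{*}A\,U_{\hat{\mathcal Y}^{\perp}}|}=\frac{|U_{\hat{\mathcal Y}_{\mathcal A}}^{*}U_{\hat{\mathcal X}_{\mathcal A}}|}{|A|_{\dagger}\,|U_{\hat{\mathcal Y}_{\mathcal A}}^{*}A^{\dagger}U_{\hat{\mathcal X}_{\mathcal A}}|},$$ and the matrices inside the determinants $|\cdot|$ above are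 (square and) non-singular.
   Context: $(\cdot)^{\dagger}$ is the Moore-Penrose pseudo-inverse, $(\cdot)^{*}$ the conjugate transpose, $(\cdot)^{\perp}$ the orthogonal complement. $|\cdot|$ denotes the determinant (equal to $1$ for an empty matrix). $|\cdot|_{\dagger}$ denotes the pseudo-determinant of a square matrix: the product of its non-zero eigenvalues (with algebraic multiplicity), with value $1$ for a nilpotent matrix. A square matrix $A$ is EP (range-Hermitian) if $\operatorname{im}(A)=\operatorname{im}(A^{*})$. The index of a square matrix $M$ is $\operatorname{ind}(M)=\min\{k\ge 1 : \operatorname{rank}(M^{k+1})=\operatorname{rank}(M^{k})\}$. *)

theory Defs
  imports
    "Jordan_Normal_Form.DL_Rank"
    "Jordan_Normal_Form.Matrix_Kernel"
    "Jordan_Normal_Form.Schur_Decomposition"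
    "Jordan_Normal_Form.Spectral_Radius"
begin

definition is_mp_inverse :: "complex mat \<Rightarrow> complex mat \<Rightarrow> bool" where
  "is_mp_inverse A B \<longleftrightarrow>
     B \<in> carrier_mat (dim_col A) (dim_row A) \<and>
     A * B * A = A \<and> B * A * B = B \<and>
     mat_adjoint (A * B) = A * B \<and> mat_adjoint (B * A) = B * A"

definition mp_inverse :: "complex mat \<Rightarrow> complex mat" where
  "mp_inverse A = (THE B. is_mp_inverse A B)"

definition im_mat :: "complex mat \<Rightarrow> complex vec set" where
  "im_mat A = vec_space.col_space (dim_row A) A"

(* The library constant orthogonal_complement uses the bilinear form, without conjugation. *)
definition ortho_compl :: "nat \<Rightarrow> complex vec set \<Rightarrow> complex vec set" where
  "ortho_compl n W = {v \<in> carrier_vec n. \<forall>w\<in>W. v \<bullet>c w = 0}"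

definition EP_mat :: "complex mat \<Rightarrow> bool" where
  "EP_mat A \<longleftrightarrow> square_mat A \<and> im_mat A = im_mat (mat_adjoint A)"

definition mat_index :: "complex mat \<Rightarrow> nat" where
  "mat_index M = (LEAST k. 1 \<le> k \<and>
     vec_space.rank (dim_row M) (M ^\<^sub>m (k + 1)) = vec_space.rank (dim_row M) (M ^\<^sub>m k))"

(* Meant for square matrices; the algebraic multiplicity of an eigenvalue is its order as a
   root of the characteristic polynomial. *)
definition pseudo_det :: "complex mat \<Rightarrow> complex" where
  "pseudo_det A = (\<Prod>a \<in> spectrum A - {0}. a ^ order a (char_poly A))"

(* The column count of U is not prescribed: it is forced to be the dimension of W, and may be 0.
   Orthonormality makes the columns distinct, so nothing is lost by passing to their set. *)
definition orthonormal_basis_mat :: "nat \<Rightarrow> complex vec set \<Rightarrow> complex mat \<Rightarrow> bool" where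
  "orthonormal_basis_mat n W U \<longleftrightarrow>
     dim_row U = n \<and>
     mat_adjoint U * U = 1\<^sub>m (dim_col U) \<and>
     vectorspace.basis class_ring ((module_vec TYPE(complex) n)\<lparr>carrier := W\<rparr>) (set (cols U))"

end

(*
  M is an outer inverse of A, that is M A M = M, and its kernel and image are compatible with the
  orthogonal projection P = A A^+ = A^+ A onto im A. With orthonormal bases V of the complement of
  ker M and W of im M one has M = W C V* with C invertible, and M A M = M forces C^-1 = V* A W.
  Since B C and C B have the same nonzero eigenvalues, |M|_+ = det (C V* W) as soon as V* W is
  non-singular, and that is what index 1 means. For the second formula extend V and W by bases a
  and b of ker M and of the complement of im M inside im A to orthonormal bases U1 = [V a] and
  U2 = [W b] of im A. Then U1* A U2 and U2* A^+ U1 are mutually inverse, and Jacobi's complementary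
  minor identity relates det (V* A W) to det (b* A^+ a); the same identity with A replaced by P
  relates det (V* W) to det (b* a).
*)

theory Submission
  imports Defs
begin

subsection \<open>Conjugate transpose\<close>

text \<open>The outer inverse property comes from \<open>T = X S Y*\<close> with S the
  pseudo-inverse of Y* A^+ X: the Penrose identity S (Y* A^+ X) S = S turns into T A^+ T = T, and M
  = A^+ - A^+ T A^+. EP makes A A^+ and A^+ A one projection P, whence M P = M and P M = M; so V and
  W both lie in im A and can both be completed there. The side of Y is the side of X for M*, because
  the complement of im M is ker M*. The two completed bases U1 and U2 differ, so det (U1* A U2) is
  not |A|_+ itself. It is |A|_+ = det (U1* A U1) times the determinant of the unitary matrix U1* U2.
  That last factor is not computed; it occurs in both minor identities and cancels in the quotient.
  The number of columns of a basis matrix is not prescribed, so no determinant is known to be square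
  at the outset. The equalities of dimensions are read off from rectangular matrices that are
  inverse to each other on both sides.\<close>

lemma mult_assoc_dim:
  fixes A B C :: "'a :: semiring_0 mat"
  shows "dim_col A = dim_row B \<Longrightarrow> dim_col B = dim_row C \<Longrightarrow> A * B * C = A * (B * C)"
  by (rule assoc_mult_mat) auto

lemma mult_minus_dim:
  fixes A B C :: "'a :: ring mat"
  shows "dim_col A = dim_row B \<Longrightarrow> dim_row C = dim_row B \<Longrightarrow> dim_col C = dim_col B \<Longrightarrow>
    A * (B - C) = A * B - A * C"
  by (rule mult_minus_distrib_mat) auto

lemma minus_mult_dim:
  fixes A B C :: "'a :: ring mat"
  shows "dim_col A = dim_row C \<Longrightarrow> dim_row B = dim_row A \<Longrightarrow> dim_col B = dim_col A \<Longrightarrow>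
    (A - B) * C = A * C - B * C"
  by (rule minus_mult_distrib_mat) auto

text \<open>\<open>mult_assoc_dim\<close> nests all products to the right, which hides a known
  product \<open>A * B\<close> behind the tail \<open>Z\<close>; this form makes it rewritable
  there.\<close>

lemma mult_left_cong:
  fixes A B C Z :: "'a :: semiring_0 mat"
  assumes "A * B = C" "dim_col A = dim_row B" "dim_col B = dim_row Z"
  shows "A * (B * Z) = C * Z"
  using assms mult_assoc_dim[of A B Z] by simp

lemma mult_left_cong3:
  fixes A B C D Z :: "'a :: semiring_0 mat"
  assumes "A * (B * C) = D" "dim_col A = dim_row B" "dim_col B = dim_row C" "dim_col C = dim_row Z"
  shows "A * (B * (C * Z)) = D * Z"
  using mult_left_cong[of A "B * C" D Z] assms by (simp add: mult_assoc_dim)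

lemma minus_zero_mat [simp]:
  fixes A :: "'a :: group_add mat"
  shows "dim_row A = m \<Longrightarrow> dim_col A = n \<Longrightarrow> A - 0\<^sub>m m n = A"
  by (rule eq_matI) auto

lemma left_mult_one_dim [simp]:
  fixes A :: "'a :: semiring_1 mat"
  shows "dim_row A = n \<Longrightarrow> 1\<^sub>m n * A = A"
  by (rule left_mult_one_mat) auto

lemma right_mult_one_dim [simp]:
  fixes A :: "'a :: semiring_1 mat"
  shows "dim_col A = n \<Longrightarrow> A * 1\<^sub>m n = A"
  by (rule right_mult_one_mat) auto

lemma minus_eq_zero_matD:
  fixes A B :: "'a :: group_add mat"
  assumes "A - B = 0\<^sub>m m n" and "dim_row A = dim_row B" "dim_col A = dim_col B"
  shows "A = B"
proof (rule eq_matI)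
  fix i j assume ij: "i < dim_row B" "j < dim_col B"
  have "dim_row (A - B) = m" "dim_col (A - B) = n" by (simp_all add: assms(1))
  hence mn: "m = dim_row B" "n = dim_col B" by simp_all
  have "(A - B) $$ (i, j) = 0" unfolding assms(1) using ij mn by simp
  thus "A $$ (i, j) = B $$ (i, j)" using ij by simp
qed (use assms in auto)

lemma minus_self_mat:
  fixes A :: "'a :: group_add mat"
  shows "A - A = 0\<^sub>m (dim_row A) (dim_col A)"
  by (rule eq_matI) auto

lemma dim_mat_adjoint [simp]:
  "dim_row (mat_adjoint A) = dim_col A" "dim_col (mat_adjoint A) = dim_row A"
  by (simp_all add: mat_adjoint_def)

lemma index_mat_adjoint [simp]:
  "i < dim_col A \<Longrightarrow> j < dim_row A \<Longrightarrow> mat_adjoint A $$ (i, j) = conjugate (A $$ (j, i))"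
  by (simp add: mat_adjoint_def mat_of_rows_index)

lemma mat_adjoint_adjoint [simp]:
  fixes A :: "'a :: conjugatable_field mat"
  shows "mat_adjoint (mat_adjoint A) = A"
  by (rule eq_matI) auto

lemma mat_adjoint_one [simp]: "mat_adjoint (1\<^sub>m n :: complex mat) = 1\<^sub>m n"
  by (rule eq_matI) auto

lemma mat_adjoint_zero [simp]:
  "mat_adjoint (0\<^sub>m m n :: 'a :: conjugatable_field mat) = 0\<^sub>m n m"
  by (rule eq_matI) auto

lemma mat_adjoint_mult:
  fixes A B :: "'a :: conjugatable_field mat"
  assumes "dim_col A = dim_row B"
  shows "mat_adjoint (A * B) = mat_adjoint B * mat_adjoint A"
proof (rule eq_matI)
  fix i j assume "i < dim_row (mat_adjoint B * mat_adjoint A)"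
    and "j < dim_col (mat_adjoint B * mat_adjoint A)"
  hence ij: "i < dim_col B" "j < dim_row A" by auto
  show "mat_adjoint (A * B) $$ (i, j) = (mat_adjoint B * mat_adjoint A) $$ (i, j)"
    using ij assms
    by (simp add: scalar_prod_def sum_conjugate conjugate_dist_mul mult.commute)
qed auto

lemma mat_adjoint_minus:
  fixes A B :: "complex mat"
  assumes "dim_row A = dim_row B" "dim_col A = dim_col B"
  shows "mat_adjoint (A - B) = mat_adjoint A - mat_adjoint B"
  by (rule eq_matI) (use assms in auto)

text \<open>The diagonal entries of B* B are the squared norms of the columns of B.\<close>

lemma mat_adjoint_mult_self_eq_zeroD:
  fixes B :: "complex mat"
  assumes "mat_adjoint B * B = 0\<^sub>m (dim_col B) (dim_col B)"
  shows "B = 0\<^sub>m (dim_row B) (dim_col B)"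
proof (rule eq_matI)
  fix i j assume "i < dim_row (0\<^sub>m (dim_row B) (dim_col B) :: complex mat)"
    and "j < dim_col (0\<^sub>m (dim_row B) (dim_col B) :: complex mat)"
  hence i: "i < dim_row B" and j: "j < dim_col B" by auto
  have "(mat_adjoint B * B) $$ (j, j) = (\<Sum>k<dim_row B. cnj (B $$ (k, j)) * B $$ (k, j))"
    using j by (simp add: scalar_prod_def atLeast0LessThan)
  also have "\<dots> = (\<Sum>k<dim_row B. of_real ((cmod (B $$ (k, j)))\<^sup>2))"
    by (intro sum.cong refl) (metis complex_norm_square mult.commute)
  finally have "complex_of_real (\<Sum>k<dim_row B. (cmod (B $$ (k, j)))\<^sup>2) = 0"
    using assms j by simp
  hence "(\<Sum>k<dim_row B. (cmod (B $$ (k, j)))\<^sup>2) = 0"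
    using of_real_eq_0_iff by blast
  hence "\<forall>k\<in>{..<dim_row B}. (cmod (B $$ (k, j)))\<^sup>2 = 0"
    by (subst (asm) sum_nonneg_eq_0_iff) auto
  thus "B $$ (i, j) = 0\<^sub>m (dim_row B) (dim_col B) $$ (i, j)" using i j by simp
qed auto


subsection \<open>The Moore-Penrose inverse\<close>

text \<open>Row reduction E = P A with invertible P reduces the claim to E: if E H E = E, then H P
  serves for A.\<close>

lemma generalized_inverse_exists:
  fixes A :: "'a :: field mat"
  shows "\<exists>G \<in> carrier_mat (dim_col A) (dim_row A). A * G * A = A"
proof -
  define m n where "m = dim_row A" and "n = dim_col A"
  have A: "A \<in> carrier_mat m n" by (auto simp: m_def n_def)
  define E where "E = gauss_jordan_single A"
  note gj = gauss_jordan_single[OF A E_def[symmetric]]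
  from gj(2) have dE: "dim_row E = m" "dim_col E = n" by auto
  from gj(3) obtain f where "pivot_fun E f n" unfolding row_echelon_form_def dE by auto
  note f = pivot_funD[OF dE(1) this]
  from gj(4) obtain P Q where PQ: "E = P * A" "P \<in> carrier_mat m m" "Q \<in> carrier_mat m m"
    "P * Q = 1\<^sub>m m" "Q * P = 1\<^sub>m m" by blast
  \<comment> \<open>The transposed pivot pattern is a generalized inverse of a reduced echelon form,
    because E H is then the diagonal 0/1 matrix marking the nonzero rows of E.\<close>
  define H where "H = mat n m (\<lambda>(j, i). if f i = j then 1 else 0 :: 'a)"
  have dH: "dim_row H = n" "dim_col H = m" by (auto simp: H_def)
  have EH: "(E * H) $$ (i, k) = (if i = k \<and> f i < n then 1 else 0)" if i: "i < m" and k: "k < m" for i k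
  proof -
    have "(E * H) $$ (i, k) = (\<Sum>j<n. E $$ (i, j) * H $$ (j, k))"
      using i k by (simp add: scalar_prod_def dE dH atLeast0LessThan)
    also have "\<dots> = (\<Sum>j<n. if f k = j then E $$ (i, f k) else 0)"
      by (intro sum.cong) (use k in \<open>auto simp: H_def\<close>)
    also have "\<dots> = (if f k < n then E $$ (i, f k) else 0)" by simp
    also have "\<dots> = (if i = k \<and> f i < n then 1 else 0)"
      using f(4)[OF k] f(5)[OF k _ i] by auto
    finally show ?thesis .
  qed
  have EHE: "E * H * E = E"
  proof (rule eq_matI)
    fix i j assume ij: "i < dim_row E" "j < dim_col E"
    have "(E * H * E) $$ (i, j) = (\<Sum>k<m. (E * H) $$ (i, k) * E $$ (k, j))"
      using ij by (simp add: scalar_prod_def dE dH atLeast0LessThan)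
    also have "\<dots> = (\<Sum>k<m. if i = k then (if f i < n then E $$ (i, j) else 0) else 0)"
      by (intro sum.cong) (use ij dE in \<open>auto simp: EH simp del: index_mult_mat\<close>)
    also have "\<dots> = (if f i < n then E $$ (i, j) else 0)" using ij dE by simp
    \<comment> \<open>A row without pivot has \<open>f i = n\<close> and is zero, so erasing it
      changes nothing.\<close>
    also have "\<dots> = E $$ (i, j)" using f(1)[of i] f(2)[of i j] ij dE by auto
    finally show "(E * H * E) $$ (i, j) = E $$ (i, j)" .
  qed (auto simp: dE dH)
  have dP: "dim_row P = m" "dim_col P = m" "dim_row Q = m" "dim_col Q = m" using PQ by auto
  have AE: "A = Q * E"
    using PQ(1) A dP mult_assoc_dim[of Q P A] by (simp add: PQ(5))
  have "A * (H * P) * A = Q * (E * H * (P * A))"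
    by (subst AE, simp add: mult_assoc_dim dE dH dP A[THEN carrier_matD(1)] A[THEN carrier_matD(2)])
  also have "\<dots> = A" by (simp only: PQ(1)[symmetric] EHE AE[symmetric])
  finally show ?thesis using dH dP by (intro bexI[of _ "H * P"]) (auto simp: m_def n_def)
qed

text \<open>With G a generalized inverse of S* S, the matrix S G S* is the orthogonal projection
  onto im S. The defect T = S G S* S - S satisfies S* T = 0, and T* T is a combination of left
  multiples of S* T, so T vanishes.\<close>

lemma hermitian_generalized_inverse_exists:
  fixes S :: "complex mat"
  shows "\<exists>G \<in> carrier_mat (dim_col S) (dim_row S).
    S * G * S = S \<and> mat_adjoint (S * G) = S * G"
proof -
  define m n where "m = dim_row S" and "n = dim_col S"
  have d: "dim_row S = m" "dim_col S = n" by (auto simp: m_def n_def)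
  let ?S = "mat_adjoint S"
  obtain G where G: "G \<in> carrier_mat n n" "?S * S * G * (?S * S) = ?S * S"
    using generalized_inverse_exists[of "?S * S"] d by auto
  have dG: "dim_row G = n" "dim_col G = n" using G by auto
  note rw = mult_assoc_dim mult_minus_dim minus_mult_dim mat_adjoint_mult mat_adjoint_minus d dG
  define T where "T = S * (G * (?S * S)) - S"
  have dT: "dim_row T = m" "dim_col T = n" by (auto simp: T_def d)
  have ST: "?S * T = 0\<^sub>m n n"
    using G(2) by (simp add: T_def rw minus_self_mat)
  have "mat_adjoint T * T = mat_adjoint (G * (?S * S)) * (?S * T) - ?S * T"
    using dT by (subst (1) T_def, simp add: rw)
  also have "\<dots> = 0\<^sub>m n n" unfolding ST by (simp add: rw minus_self_mat)
  finally have "T = 0\<^sub>m m n" using mat_adjoint_mult_self_eq_zeroD[of T] dT by simp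
  hence SG: "S * (G * (?S * S)) = S"
    unfolding T_def by (rule minus_eq_zero_matD) (auto simp: d)
  define R where "R = S * (G * ?S)"
  \<comment> \<open>G need not be Hermitian, but R R* always is; so R R* = R* forces R to be
    Hermitian.\<close>
  have "R * mat_adjoint R = S * (G * (?S * S)) * (mat_adjoint G * ?S)"
    by (simp add: R_def rw)
  also have "\<dots> = mat_adjoint R" unfolding SG by (simp add: R_def rw)
  finally have *: "R * mat_adjoint R = mat_adjoint R" .
  have "mat_adjoint R = mat_adjoint (R * mat_adjoint R)"
    by (simp add: mat_adjoint_mult) (simp add: *)
  also have "\<dots> = R" unfolding * by simp
  finally have "mat_adjoint R = R" .
  thus ?thesis using SG
    by (intro bexI[of _ "G * ?S"]) (auto simp: rw R_def intro!: carrier_matI)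
qed

text \<open>Two generalized inverses are glued: if S G and F S are Hermitian, then N = F S G
  satisfies S N = S G and N S = F S. The factor F is obtained by applying the one-sided result to
  S*.\<close>

lemma mp_inverse_exists:
  fixes S :: "complex mat"
  shows "\<exists>N. is_mp_inverse S N"
proof -
  define m n where "m = dim_row S" and "n = dim_col S"
  have d: "dim_row S = m" "dim_col S = n" by (auto simp: m_def n_def)
  obtain G where G: "G \<in> carrier_mat n m" "S * G * S = S" "mat_adjoint (S * G) = S * G"
    using hermitian_generalized_inverse_exists[of S] d by auto
  obtain H where H: "H \<in> carrier_mat m n" "mat_adjoint S * H * mat_adjoint S = mat_adjoint S"
    "mat_adjoint (mat_adjoint S * H) = mat_adjoint S * H"
    using hermitian_generalized_inverse_exists[of "mat_adjoint S"] d by auto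
  have dd: "dim_row G = n" "dim_col G = m" "dim_row H = m" "dim_col H = n" using G H by auto
  note rw = mult_assoc_dim mat_adjoint_mult d dd
  define F where "F = mat_adjoint H"
  have dF: "dim_row F = n" "dim_col F = m" by (auto simp: F_def dd)
  have F1: "S * (F * S) = S"
    using arg_cong[OF H(2), of mat_adjoint] by (simp add: rw F_def)
  have F2: "mat_adjoint (F * S) = F * S"
    using H(3) by (simp add: rw F_def)
  have G1: "S * (G * S) = S" using G(2) by (simp add: rw)
  define N where "N = F * (S * G)"
  have SN: "S * N = S * G"
    unfolding N_def using F1 mult_left_cong[of S "F * S" S G] by (simp add: rw dF)
  have NS: "N * S = F * S"
    unfolding N_def using G1 by (simp add: rw dF)
  have "is_mp_inverse S N" unfolding is_mp_inverse_def
  proof (intro conjI)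
    show "N \<in> carrier_mat (dim_col S) (dim_row S)" by (auto simp: N_def d dF dd)
    show "S * N * S = S" unfolding SN by (rule G(2))
    show "mat_adjoint (S * N) = S * N" unfolding SN by (rule G(3))
    show "mat_adjoint (N * S) = N * S" unfolding NS by (rule F2)
    have "N * S * N = F * (S * N)" unfolding NS by (simp add: rw dF N_def)
    also have "\<dots> = N" unfolding SN by (simp add: N_def)
    finally show "N * S * N = N" .
  qed
  thus ?thesis ..
qed

lemma is_mp_inverse_unique:
  assumes B: "is_mp_inverse A B" and C: "is_mp_inverse A C"
  shows "B = C"
proof -
  have d: "dim_row B = dim_col A" "dim_col B = dim_row A" "dim_row C = dim_col A" "dim_col C = dim_row A"
    using B C by (auto simp: is_mp_inverse_def)
  note B' = B[unfolded is_mp_inverse_def] and C' = C[unfolded is_mp_inverse_def]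
  have "A * B = mat_adjoint (A * C * A * B)" using B' C' by simp
  also have "\<dots> = mat_adjoint (A * C * (A * B))" by (simp add: mult_assoc_dim d)
  also have "\<dots> = (A * B) * (A * C)" using B' C' d by (subst mat_adjoint_mult) simp_all
  also have "\<dots> = A * B * A * C" by (simp add: mult_assoc_dim d)
  also have "\<dots> = A * C" using B' by simp
  finally have AB: "A * B = A * C" .
  have "B * A = mat_adjoint (B * (A * C * A))" using B' C' by simp
  also have "\<dots> = mat_adjoint (B * A * (C * A))" by (simp add: mult_assoc_dim d)
  also have "\<dots> = (C * A) * (B * A)" using B' C' d by (subst mat_adjoint_mult) simp_all
  also have "\<dots> = C * (A * B * A)" by (simp add: mult_assoc_dim d)
  also have "\<dots> = C * A" using B' by simp
  finally have BA: "B * A = C * A" .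
  have "B = B * A * B" using B' by simp
  also have "\<dots> = C * A * B" unfolding BA ..
  also have "\<dots> = C * (A * B)" by (simp add: mult_assoc_dim d)
  also have "\<dots> = C * A * C" unfolding AB by (simp add: mult_assoc_dim d)
  also have "\<dots> = C" using C' by simp
  finally show ?thesis .
qed

lemma is_mp_inverse_mp_inverse: "is_mp_inverse A (mp_inverse A)"
  unfolding mp_inverse_def using mp_inverse_exists is_mp_inverse_unique by (metis theI')

lemma dim_mp_inverse [simp]:
  "dim_row (mp_inverse A) = dim_col A" "dim_col (mp_inverse A) = dim_row A"
  using is_mp_inverse_mp_inverse[of A] by (auto simp: is_mp_inverse_def)

lemma mp_inverse_props:
  "A * (mp_inverse A * A) = A"
  "mp_inverse A * (A * mp_inverse A) = mp_inverse A"
  "mat_adjoint (A * mp_inverse A) = A * mp_inverse A"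
  "mat_adjoint (mp_inverse A * A) = mp_inverse A * A"
  using is_mp_inverse_mp_inverse[of A] by (auto simp: is_mp_inverse_def mult_assoc_dim)

subsection \<open>The pseudo-determinant of a product\<close>

text \<open>The powers of x account for the surplus zero eigenvalues when \<open>n\<close> and
  \<open>r\<close> differ; away from 0 the multiplicities of both products agree.\<close>

lemma char_poly_mult_commute:
  fixes B C :: "'a :: idom mat"
  assumes B: "B \<in> carrier_mat n r" and C: "C \<in> carrier_mat r n"
  shows "[:0, 1:] ^ r * char_poly (B * C) = [:0, 1:] ^ n * char_poly (C * B)"
proof -
  interpret h: comm_ring_hom "\<lambda>a :: 'a. [:a:]" by unfold_locales auto
  define b c where "b = map_mat (\<lambda>a. [:a:]) B" and "c = map_mat (\<lambda>a. [:a:]) C"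
  have b: "b \<in> carrier_mat n r" and c: "c \<in> carrier_mat r n" using B C by (auto simp: b_def c_def)
  define X where "X = (\<lambda>n. [:0, 1:] \<cdot>\<^sub>m 1\<^sub>m n :: 'a poly mat)"
  have X: "X n \<in> carrier_mat n n" for n by (simp add: X_def)
  have cp: "char_poly_matrix (F * G) = X m + - (map_mat (\<lambda>a. [:a:]) F * map_mat (\<lambda>a. [:a:]) G)"
    if "F \<in> carrier_mat m k" "G \<in> carrier_mat k m" for F G :: "'a mat" and m k
    unfolding h.mat_hom_mult[OF that, symmetric] char_poly_matrix_def X_def
    by (rule eq_matI) (use that in auto)
  have bc: "b * c \<in> carrier_mat n n" and cb: "c * b \<in> carrier_mat r r" using b c by auto
  have dX: "det (X k) = [:0, 1:] ^ k" for k by (simp add: X_def det_smult)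
  \<comment> \<open>Two block eliminations of the same matrix evaluate its determinant in two ways.\<close>
  let ?G = "four_block_mat (X n) b c (1\<^sub>m r)"
  have G: "?G \<in> carrier_mat (n + r) (n + r)" by (rule four_block_carrier_mat) (auto simp: X)
  let ?L = "four_block_mat (1\<^sub>m n) (0\<^sub>m n r) (- c) (1\<^sub>m r)"
  have L: "?L \<in> carrier_mat (n + r) (n + r)" by (rule four_block_carrier_mat) auto
  have detL: "det ?L = 1"
    by (subst det_four_block_mat_upper_right_zero[of _ n _ r]) (use c in auto)
  have "?G * ?L = four_block_mat (X n + - (b * c)) b (0\<^sub>m r n) (1\<^sub>m r)"
    by (subst mult_four_block_mat[OF X b c one_carrier_mat one_carrier_mat zero_carrier_mat])
       (use b c X[of n] bc in \<open>auto intro!: cong_four_block_mat simp: uminus_l_inv_mat\<close>)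
  hence "det (?G * ?L) = det (X n + - (b * c))"
    by (simp, subst det_four_block_mat_lower_left_zero[of _ n _ r]) (use b bc X[of n] in auto)
  hence "det ?G = det (X n + - (b * c))" by (simp add: det_mult[OF G L] detL)
  hence 1: "det ?G = char_poly (B * C)"
    unfolding char_poly_def cp[OF B C] b_def c_def .
  let ?R = "four_block_mat (1\<^sub>m n) (0\<^sub>m n r) (- c) (X r)"
  have R: "?R \<in> carrier_mat (n + r) (n + r)" by (rule four_block_carrier_mat) (auto simp: X)
  have detR: "det ?R = [:0, 1:] ^ r"
    by (subst det_four_block_mat_upper_right_zero[of _ n _ r]) (use c X[of r] in \<open>auto simp: dX\<close>)
  have Xc: "- (c * X n) + X r * c = 0\<^sub>m r n"
  proof -
    have "c * X n = X r * c"
      unfolding X_def using c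
      by (subst mult_smult_distrib[OF c one_carrier_mat], subst mult_smult_assoc_mat[OF one_carrier_mat c]) simp
    thus ?thesis using c X[of r] by (simp add: uminus_l_inv_mat[of _ r n])
  qed
  have "?R * ?G = four_block_mat (X n) b (0\<^sub>m r n) (X r + - (c * b))"
    by (subst mult_four_block_mat[OF one_carrier_mat zero_carrier_mat uminus_carrier_mat[OF c] X X b c one_carrier_mat])
       (use b c X[of n] X[of r] cb Xc in \<open>auto intro!: cong_four_block_mat simp: comm_add_mat[of _ r r]\<close>)
  hence "det (?R * ?G) = [:0, 1:] ^ n * det (X r + - (c * b))"
    by (simp, subst det_four_block_mat_lower_left_zero[of _ n _ r])
       (use b cb X[of n] X[of r] in \<open>auto simp: dX\<close>)
  hence "[:0, 1:] ^ r * det ?G = [:0, 1:] ^ n * det (X r + - (c * b))"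
    by (simp add: det_mult[OF R G] detR)
  hence 2: "[:0, 1:] ^ r * det ?G = [:0, 1:] ^ n * char_poly (C * B)"
    unfolding char_poly_def cp[OF C B] b_def c_def .
  show ?thesis using 1 2 by simp
qed

lemma order_prod_list_linear:
  fixes a :: "'a :: idom"
  shows "order a (\<Prod>x\<leftarrow>xs. [:- x, 1:]) = count (mset xs) a"
proof (induction xs)
  case (Cons x xs)
  have "(\<Prod>x\<leftarrow>x # xs. [:- x, 1:]) \<noteq> 0" by (subst prod_list_zero_iff) auto
  hence "[:- x, 1:] * (\<Prod>x\<leftarrow>xs. [:- x, 1:]) \<noteq> 0" by simp
  from order_mult[OF this] show ?case using Cons by (simp add: order_linear' del: mult_pCons_left)
qed (simp add: order_1_eq_0)

lemma poly_prod_list_linear_0: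
  fixes xs :: "'a :: comm_ring_1 list"
  shows "poly (\<Prod>x\<leftarrow>xs. [:- x, 1:]) 0 = (- 1) ^ length xs * prod_list xs"
  by (induction xs) auto

text \<open>The characteristic polynomial splits over the complex numbers; at 0 it equals det (-A),
  and the signs on both sides cancel. The product is written in the shape of
  \<open>pseudo_det\<close>.\<close>

lemma det_eq_prod_roots_char_poly:
  fixes A :: "complex mat"
  assumes A: "A \<in> carrier_mat n n"
  shows "det A = (\<Prod>a | poly (char_poly A) a = 0. a ^ order a (char_poly A))"
proof -
  obtain as where as: "char_poly A = (\<Prod>a\<leftarrow>as. [:- a, 1:])" "length as = n"
    using char_poly_factorized[OF A] by blast
  have "char_matrix A 0 = A" using A by (auto simp: char_matrix_def intro!: eq_matI)
  hence "poly (char_poly A) 0 = det (- A)"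
    using char_poly_matrix[OF A, of 0] by simp
  also have "\<dots> = (- 1) ^ n * det A" using A
    proof -
    have "- A = (- 1) \<cdot>\<^sub>m A" by (rule eq_matI) auto
    thus ?thesis using A by simp
  qed
  finally have "(- 1) ^ n * det A = (- 1) ^ length as * prod_list as"
    unfolding as(1) poly_prod_list_linear_0 ..
  hence "det A = prod_mset (mset as)" using as(2) by (simp add: prod_mset_prod_list)
  also have "\<dots> = (\<Prod>a\<in>set as. a ^ count (mset as) a)"
    by (subst prod_mset_multiplicity) simp
  also have "\<dots> = (\<Prod>a | poly (char_poly A) a = 0. a ^ order a (char_poly A))"
    unfolding as(1) by (rule prod.cong) (auto simp: order_prod_list_linear poly_prod_list prod_list_zero_iff)
  finally show ?thesis .
qed

text \<open>Since C B is non-singular, the roots of its characteristic polynomial are exactly the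
  nonzero eigenvalues of B C, with the same orders.\<close>

lemma pseudo_det_mult:
  assumes B: "B \<in> carrier_mat n r" and C: "C \<in> carrier_mat r n" and nz: "det (C * B) \<noteq> 0"
  shows "pseudo_det (B * C) = det (C * B)"
proof -
  have BC: "B * C \<in> carrier_mat n n" and CB: "C * B \<in> carrier_mat r r" using B C by auto
  let ?p = "char_poly (B * C)" and ?q = "char_poly (C * B)"
  have eq: "[:0, 1:] ^ r * ?p = [:0, 1:] ^ n * ?q" by (rule char_poly_mult_commute[OF B C])
  have nz_p: "?p \<noteq> 0" and nz_q: "?q \<noteq> 0"
    using degree_monic_char_poly[OF BC] degree_monic_char_poly[OF CB] by auto
  have q0: "poly ?q 0 \<noteq> 0"
  proof -
    \<comment> \<open>If 0 were a root, its factor in the root product for det (C B) would be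
      nonzero, which forces order 0, and a root of a nonzero polynomial has positive order.\<close>
    have "0 ^ order 0 ?q \<noteq> (0 :: complex)" if "poly ?q 0 = 0"
      using nz that unfolding det_eq_prod_roots_char_poly[OF CB] 
      by (subst (asm) prod_zero_iff) (auto simp: poly_roots_finite nz_q)
    thus ?thesis using nz_q by (metis order_root power_0_left)
  qed
  have ord: "order a ?p = order a ?q" if "a \<noteq> 0" for a
  proof -
    have X: "order a ([:0, 1:] ^ k) = 0" for k
      using that by (intro order_0I) simp
    show ?thesis using arg_cong[OF eq, of "order a"] nz_p nz_q by (simp add: order_mult X)
  qed
  have root: "poly ?p a = 0 \<longleftrightarrow> poly ?q a = 0" if "a \<noteq> 0" for a
    using ord[OF that] nz_p nz_q by (simp add: order_root)
  have "spectrum (B * C) - {0} = {a. poly ?q a = 0}"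
  proof (rule Set.set_eqI)
    fix a show "a \<in> spectrum (B * C) - {0} \<longleftrightarrow> a \<in> {a. poly ?q a = 0}"
      unfolding spectrum_root_char_poly[OF BC] by (cases "a = 0") (simp_all add: q0 root)
  qed
  hence "pseudo_det (B * C) = (\<Prod>a | poly ?q a = 0. a ^ order a ?p)"
    by (simp add: pseudo_det_def)
  also have "\<dots> = (\<Prod>a | poly ?q a = 0. a ^ order a ?q)"
  proof (rule prod.cong)
    fix a assume "a \<in> {a. poly ?q a = 0}"
    hence "a \<noteq> 0" using q0 by auto
    from ord[OF this] show "a ^ order a ?p = a ^ order a ?q" by (rule arg_cong)
  qed simp
  also have "\<dots> = det (C * B)" by (rule det_eq_prod_roots_char_poly[OF CB, symmetric])
  finally show ?thesis .
qed

subsection \<open>Rank, image and index\<close>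

text \<open>A basis of \<open>X\<close> stays independent in the whole space and has enough elements
  to be a basis of it.\<close>

lemma (in vectorspace) subspace_dim_eqD:
  assumes X: "VectorSpace.subspace K X V" and fd: "fin_dim" and fdX: "vectorspace.fin_dim K (vs X)"
    and le: "dim \<le> vectorspace.dim K (vs X)"
  shows "X = carrier V"
proof -
  interpret X: vectorspace K "vs X" by (rule subspace_is_vs[OF X])
  have sub: "submodule K X V" using X by (rule is_module)
  obtain b where b: "finite b" "X.basis b" using X.finite_basis_exists fdX by blast
  have bX: "b \<subseteq> X" "X.lin_indpt b" "X.span b = X" using b(2) unfolding X.basis_def by auto
  have XV: "X \<subseteq> carrier V" using sub by (rule submodule.subset)
  have li: "lin_indpt b" using span_li_not_depend(2)[OF bX(1) sub] bX(2) by simp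
  have "X.dim = card b" using X.dim_basis b by blast
  with le have "dim \<le> card b" by simp
  hence "basis b" using dim_li_is_basis[OF fd b(1) _ li] bX(1) XV by auto
  hence "span b = carrier V" unfolding basis_def by auto
  thus ?thesis using span_li_not_depend(1)[OF bX(1) sub] bX(3) by simp
qed

context vec_space
begin

lemma subspace_col_space:
  assumes "A \<in> carrier_mat n m"
  shows "VectorSpace.subspace class_ring (col_space A) V"
  unfolding col_space_def by (rule span_is_subspace) (use assms cols_dim[of A] in auto)

lemma col_space_mult_subset:
  assumes A: "A \<in> carrier_mat n m" and B: "B \<in> carrier_mat m k"
  shows "col_space (A * B) \<subseteq> col_space A"
proof -
  have AB: "A * B \<in> carrier_mat n k" using A B by simp
  show ?thesis unfolding col_space_eq[OF A] col_space_eq[OF AB]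
    using A B by (auto intro!: bexI[of _ "B *\<^sub>v _"])
qed

lemma
  assumes A: "A \<in> carrier_mat n m" and B: "B \<in> carrier_mat m k"
  shows rank_mult_le_left: "rank (A * B) \<le> rank A"
    and col_space_mult_eqI: "rank (A * B) = rank A \<Longrightarrow> col_space (A * B) = col_space A"
proof -
  have AB: "A * B \<in> carrier_mat n k" using A B by simp
  note S = subspace_col_space[OF A] subspace_col_space[OF AB]
  interpret W: vectorspace class_ring "vs (col_space A)" by (rule subspace_is_vs[OF S(1)])
  have sub: "VectorSpace.subspace class_ring (col_space (A * B)) (vs (col_space A))"
    by (rule nested_subspaces[OF S col_space_mult_subset[OF A B]])
  have fd: "W.fin_dim" "vectorspace.fin_dim class_ring (vs (col_space (A * B)))"
    unfolding col_space_def using fin_dim_span_cols A AB by auto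
  have rank: "rank C = vectorspace.dim class_ring (vs (col_space C))" for C
    by (simp add: rank_def col_space_def)
  show "rank (A * B) \<le> rank A"
    using W.subspace_dim[OF sub fd(1)] fd(2) by (simp add: rank)
  show "col_space (A * B) = col_space A" if "rank (A * B) = rank A"
    using W.subspace_dim_eqD[OF sub fd(1)] fd(2) that by (simp add: rank)
qed

end

lemma col_mult_dim:
  fixes A B :: "'a :: semiring_0 mat"
  shows "dim_col A = dim_row B \<Longrightarrow> j < dim_col B \<Longrightarrow> col (A * B) j = A *\<^sub>v col B j"
  by (rule col_mult2) auto

lemma im_mat_eq: "im_mat A = {A *\<^sub>v x | x. x \<in> carrier_vec (dim_col A)}"
proof -
  have "A \<in> carrier_mat (dim_row A) (dim_col A)" by simp
  from vec_space.col_space_eq[OF this] show ?thesis unfolding im_mat_def by (auto intro!: carrier_vecI)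
qed

text \<open>Choosing a preimage for each column turns membership in an image into a matrix equation,
  so that later arguments can compute with matrices instead of vectors.\<close>

lemma factor_through_im_mat:
  assumes d: "dim_row F = dim_row G" and F: "\<And>j. j < dim_col F \<Longrightarrow> col F j \<in> im_mat G"
  shows "\<exists>Z \<in> carrier_mat (dim_col G) (dim_col F). F = G * Z"
proof -
  have "\<exists>x. x \<in> carrier_vec (dim_col G) \<and> G *\<^sub>v x = col F j" if "j < dim_col F" for j
    using F[OF that] by (auto simp: im_mat_eq)
  then obtain x where x: "\<And>j. j < dim_col F \<Longrightarrow> x j \<in> carrier_vec (dim_col G)"
    "\<And>j. j < dim_col F \<Longrightarrow> G *\<^sub>v x j = col F j" by metis
  define Z where "Z = mat (dim_col G) (dim_col F) (\<lambda>(i, j). x j $ i)"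
  have "col Z j = x j" if "j < dim_col F" for j
    using that x(1)[OF that] by (auto simp: Z_def intro!: eq_vecI)
  moreover have dZ: "dim_row Z = dim_col G" "dim_col Z = dim_col F" by (auto simp: Z_def)
  ultimately have "F = G * Z"
    using d x(2) by (intro mat_col_eqI) (auto simp: col_mult_dim)
  thus ?thesis using dZ by blast
qed

lemma im_mat_subset_factor:
  assumes "dim_row F = dim_row G" and "im_mat F \<subseteq> im_mat G"
  shows "\<exists>Z \<in> carrier_mat (dim_col G) (dim_col F). F = G * Z"
proof (rule factor_through_im_mat[OF assms(1)])
  fix j assume "j < dim_col F"
  hence "col F j = F *\<^sub>v col (1\<^sub>m (dim_col F)) j"
    using col_mult_dim[of F "1\<^sub>m (dim_col F)" j] by simp
  moreover have "col (1\<^sub>m (dim_col F)) j \<in> carrier_vec (dim_col F)" by (rule carrier_vecI) simp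
  ultimately have "col F j \<in> im_mat F" unfolding im_mat_eq by blast
  thus "col F j \<in> im_mat G" using assms(2) by blast
qed

text \<open>Index 1 means that M and M M have equal rank, hence equal image, so M factors through M
  M.\<close>

lemma index_1_factor:
  assumes M: "M \<in> carrier_mat n n" and ind: "mat_index M = 1"
  shows "\<exists>Z \<in> carrier_mat n n. M = M * M * Z"
proof -
  interpret vec_space "TYPE(complex)" n .
  define r where "r k = rank (M ^\<^sub>m k)" for k
  have le: "r (Suc k) \<le> r k" for k
    unfolding r_def using rank_mult_le_left[of "M ^\<^sub>m k" n M n] M by simp
  \<comment> \<open>The value of \<open>LEAST\<close> carries information only if some
    \<open>k\<close> qualifies; the ranks of the powers cannot decrease forever.\<close>
  have "\<exists>k\<ge>1. r (k + 1) = r k"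
  proof (rule ccontr)
    assume neg: "\<not> ?thesis"
    have less: "r (Suc k) < r k" if "k \<ge> 1" for k using le[of k] neg that by fastforce
    have "r (Suc k) + k \<le> r 1" for k
    proof (induction k)
      case (Suc k)
      thus ?case using less[of "Suc k"] by simp
    qed simp
    from this[of "Suc (r 1)"] show False by simp
  qed
  moreover have "mat_index M = (LEAST k. 1 \<le> k \<and> r (k + 1) = r k)"
    using M by (simp add: mat_index_def r_def)
  ultimately have "r (1 + 1) = r 1"
    using LeastI_ex[of "\<lambda>k. 1 \<le> k \<and> r (k + 1) = r k"] ind by metis
  hence "rank (M * M) = rank M" using M by (simp add: r_def)
  hence "col_space (M * M) = col_space M" by (rule col_space_mult_eqI[OF M M])
  hence "im_mat M \<subseteq> im_mat (M * M)" using M by (simp add: im_mat_def)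
  from im_mat_subset_factor[OF _ this] show ?thesis using M by auto
qed

subsection \<open>Orthonormal bases\<close>

lemma submodule_vecI:
  fixes W :: "'a :: field vec set"
  assumes "W \<subseteq> carrier_vec n" "0\<^sub>v n \<in> W" "\<And>v w. v \<in> W \<Longrightarrow> w \<in> W \<Longrightarrow> v + w \<in> W"
    "\<And>c v. v \<in> W \<Longrightarrow> c \<cdot>\<^sub>v v \<in> W"
  shows "submodule class_ring W (module_vec TYPE('a) n)"
  by (rule submodule.intro[OF vec_module])
     (use assms in \<open>auto simp: module_vec_simps class_ring_simps\<close>)

lemma submodule_Int:
  assumes "submodule R W M" "submodule R X M"
  shows "submodule R (W \<inter> X) M"
  using assms unfolding submodule_def by auto

lemma submodule_mat_kernel:
  fixes M :: "'a :: field mat"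
  assumes M: "M \<in> carrier_mat m n"
  shows "submodule class_ring (mat_kernel M) (module_vec TYPE('a) n)"
  by (rule submodule_vecI)
     (use M in \<open>auto simp: mat_kernel_def mult_add_distrib_mat_vec[of _ m n] mult_mat_vec[of _ m n]\<close>)

lemma submodule_ortho_compl:
  assumes W: "W \<subseteq> carrier_vec n"
  shows "submodule class_ring (ortho_compl n W) (module_vec TYPE(complex) n)"
  by (rule submodule_vecI)
     (use W in \<open>auto simp: ortho_compl_def add_scalar_prod_distrib[of _ n] subset_iff\<close>)

lemma submodule_im_mat:
  assumes A: "A \<in> carrier_mat n m"
  shows "submodule class_ring (im_mat A) (module_vec TYPE(complex) n)"
proof -
  interpret vec_space "TYPE(complex)" n .
  show ?thesis using is_module[OF subspace_col_space[OF A]] A by (simp add: im_mat_def)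
qed

text \<open>U U* is the orthogonal projection onto W and so fixes every matrix with columns in W.
  Being a basis is stated in the module with carrier \<open>W\<close>; as \<open>W\<close> is a
  submodule, its span there is the span in the ambient space.\<close>

lemma orthonormal_basis_matD:
  assumes U: "orthonormal_basis_mat n W U" and W: "submodule class_ring W (module_vec TYPE(complex) n)"
  shows "dim_row U = n" "mat_adjoint U * U = 1\<^sub>m (dim_col U)"
    "\<And>j. j < dim_col U \<Longrightarrow> col U j \<in> W"
    "\<And>F. dim_row F = n \<Longrightarrow> (\<And>j. j < dim_col F \<Longrightarrow> col F j \<in> W) \<Longrightarrow> U * (mat_adjoint U * F) = F"
proof -
  interpret vec_space "TYPE(complex)" n .
  show n: "dim_row U = n" and on: "mat_adjoint U * U = 1\<^sub>m (dim_col U)"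
    using U by (auto simp: orthonormal_basis_mat_def)
  have "vectorspace.basis class_ring (vs W) (set (cols U))"
    using U by (simp add: orthonormal_basis_mat_def)
  moreover have "VectorSpace.subspace class_ring W V"
    using W by (simp add: VectorSpace.subspace_def vectorspace_axioms)
  hence "vectorspace class_ring (vs W)" by (rule subspace_is_vs)
  ultimately have b: "set (cols U) \<subseteq> W" "LinearCombinations.module.span class_ring (vs W) (set (cols U)) = W"
    by (auto simp: vectorspace.basis_def)
  show "\<And>j. j < dim_col U \<Longrightarrow> col U j \<in> W" using b(1) by (auto simp: cols_def)
  have "span (set (cols U)) = W" using span_li_not_depend(1)[OF b(1) W] b(2) by simp
  hence imU: "im_mat U = W" by (simp add: im_mat_def n col_space_def)
  fix F :: "complex mat" assume F: "dim_row F = n" "\<And>j. j < dim_col F \<Longrightarrow> col F j \<in> W"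
  obtain Z where Z: "Z \<in> carrier_mat (dim_col U) (dim_col F)" "F = U * Z"
    using factor_through_im_mat[of F U] F n imU by auto
  have "mat_adjoint U * F = Z" using Z(1) mult_left_cong[OF on, of Z] by (simp add: Z(2))
  thus "U * (mat_adjoint U * F) = F" using Z(2) by simp
qed

lemma mat_adjoint_mult_index:
  fixes F G :: "complex mat"
  assumes "dim_row F = dim_row G" "i < dim_col F" "j < dim_col G"
  shows "(mat_adjoint F * G) $$ (i, j) = col G j \<bullet>c col F i"
  using assms by (simp add: scalar_prod_def mult.commute)

lemma mult_eq_zero_colsI:
  assumes "\<And>j. j < dim_col B \<Longrightarrow> col B j \<in> mat_kernel A" and "dim_row B = dim_col A"
  shows "A * B = 0\<^sub>m (dim_row A) (dim_col B)"
  by (rule mat_col_eqI) (use assms in \<open>auto simp: mat_kernel_def col_mult_dim\<close>)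

lemma col_in_mat_kernelI:
  assumes "A * B = 0\<^sub>m (dim_row A) (dim_col B)" and "dim_row B = dim_col A" and "j < dim_col B"
  shows "col B j \<in> mat_kernel A"
proof -
  have "A *\<^sub>v col B j = col (A * B) j"
    using assms(2,3) by (simp add: col_mult_dim)
  also have "\<dots> = 0\<^sub>v (dim_row A)" unfolding assms(1) using assms(3) by auto
  finally show ?thesis using assms(2,3) by (auto simp: mat_kernel_def intro!: carrier_vecI)
qed

subsection \<open>Block matrices\<close>

text \<open>An identity matrix of size m that factors through dimension k has rank m at most k;
  apply this to both products.\<close>

lemma mult_one_dims_eq:
  fixes A B :: "'a :: field mat"
  assumes A: "A \<in> carrier_mat m k" and B: "B \<in> carrier_mat k m"
    and AB: "A * B = 1\<^sub>m m" and BA: "B * A = 1\<^sub>m k"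
  shows "m = k"
proof -
  have *: "m \<le> k" if "A \<in> carrier_mat m k" "B \<in> carrier_mat k m" "A * B = 1\<^sub>m m"
    for A B :: "'a mat" and m k
  proof -
    have "vec_space.rank m (A * B) = m"
      unfolding that(3) by (rule vec_space.det_rank_iff[THEN iffD1]) auto
    moreover have "vec_space.rank m (A * B) \<le> vec_space.rank m A"
      by (rule vec_space.rank_mult_le_left[OF that(1,2)])
    moreover have "vec_space.rank m A \<le> k" by (rule vec_space.rank_le_nc[OF that(1)])
    ultimately show ?thesis by simp
  qed
  show ?thesis using *[OF A B AB] *[OF B A BA] by simp
qed

lemma invertible_matI_det:
  fixes A :: "'a :: field mat"
  assumes sq: "dim_row A = dim_col A" and nz: "det A \<noteq> 0"
  shows "invertible_mat A"
proof -
  define n where "n = dim_row A"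
  have A: "A \<in> carrier_mat n n" using sq by (auto simp: n_def)
  obtain B where "B \<in> carrier_mat n n" "A * B = 1\<^sub>m n" "B * A = 1\<^sub>m n"
    using det_non_zero_imp_unit[OF A nz, of "()"] unfolding Units_def ring_mat_def by auto
  thus ?thesis using A by (auto simp: invertible_mat_def inverts_mat_def)
qed

text \<open>Jacobi's complementary minor identity without division, so that neither
  \<open>G11\<close> nor \<open>H22\<close> has to be invertible. Empty blocks are allowed.\<close>

lemma det_block_inverse:
  fixes G11 :: "'a :: idom mat"
  assumes G: "G11 \<in> carrier_mat r r" "G12 \<in> carrier_mat r k" "G21 \<in> carrier_mat k r" "G22 \<in> carrier_mat k k"
    and H: "H11 \<in> carrier_mat r r" "H12 \<in> carrier_mat r k" "H21 \<in> carrier_mat k r" "H22 \<in> carrier_mat k k"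
    and GH: "four_block_mat G11 G12 G21 G22 * four_block_mat H11 H12 H21 H22 = 1\<^sub>m (r + k)"
  shows "det (four_block_mat G11 G12 G21 G22) * det H22 = det G11"
proof -
  let ?G = "four_block_mat G11 G12 G21 G22"
  \<comment> \<open>Replacing the first block column of H by that of the identity turns G H = 1 into a block
    triangular product.\<close>
  let ?T = "four_block_mat (1\<^sub>m r) H12 (0\<^sub>m k r) H22"
  have c: "?G \<in> carrier_mat (r + k) (r + k)" "?T \<in> carrier_mat (r + k) (r + k)"
    using G H by (auto intro!: four_block_carrier_mat)
  have E: "four_block_mat (G11 * H11 + G12 * H21) (G11 * H12 + G12 * H22)
      (G21 * H11 + G22 * H21) (G21 * H12 + G22 * H22) = 1\<^sub>m (r + k)" (is "four_block_mat ?a ?b ?c ?d = _")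
    using GH by (simp add: mult_four_block_mat[OF G H])
  have b: "?b = 0\<^sub>m r k"
  proof (rule eq_matI)
    fix i j assume "i < dim_row (0\<^sub>m r k :: 'a mat)" "j < dim_col (0\<^sub>m r k :: 'a mat)"
    thus "?b $$ (i, j) = 0\<^sub>m r k $$ (i, j)"
      using arg_cong[OF E, of "\<lambda>M. M $$ (i, r + j)"] G H by simp
  qed (use G H in auto)
  have d: "?d = 1\<^sub>m k"
  proof (rule eq_matI)
    fix i j assume "i < dim_row (1\<^sub>m k :: 'a mat)" "j < dim_col (1\<^sub>m k :: 'a mat)"
    thus "?d $$ (i, j) = 1\<^sub>m k $$ (i, j)"
      using arg_cong[OF E, of "\<lambda>M. M $$ (r + i, r + j)"] G H by simp
  qed (use G H in auto)
  have "?G * ?T = four_block_mat G11 ?b G21 ?d"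
    by (subst mult_four_block_mat[OF G one_carrier_mat H(2) zero_carrier_mat H(4)])
       (use G H in \<open>auto intro!: cong_four_block_mat\<close>)
  hence "det (?G * ?T) = det G11"
    unfolding b d by (simp, subst det_four_block_mat_upper_right_zero[of _ r _ k]) (use G in auto)
  moreover have "det ?T = det H22"
    by (subst det_four_block_mat_lower_left_zero[of _ r _ k]) (use H in auto)
  ultimately show ?thesis by (simp add: det_mult[OF c])
qed

(* The lower blocks have no rows, so that mult_four_block_mat applies to U = [F G]. *)
definition append_mat_cols :: "'a :: zero mat \<Rightarrow> 'a mat \<Rightarrow> 'a mat" where
  "append_mat_cols F G = four_block_mat F G (0\<^sub>m 0 (dim_col F)) (0\<^sub>m 0 (dim_col G))"

lemma dim_append_mat_cols [simp]:
  "dim_row (append_mat_cols F G) = dim_row F"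
  "dim_col (append_mat_cols F G) = dim_col F + dim_col G"
  by (simp_all add: append_mat_cols_def)

lemma append_mat_cols_sandwich:
  fixes T :: "complex mat"
  assumes F: "F1 \<in> carrier_mat n f1" "F2 \<in> carrier_mat n f2"
    and G: "G1 \<in> carrier_mat m g1" "G2 \<in> carrier_mat m g2" and T: "T \<in> carrier_mat n m"
  shows "mat_adjoint (append_mat_cols F1 F2) * (T * append_mat_cols G1 G2) =
    four_block_mat (mat_adjoint F1 * (T * G1)) (mat_adjoint F1 * (T * G2))
      (mat_adjoint F2 * (T * G1)) (mat_adjoint F2 * (T * G2))"
proof -
  have adj: "mat_adjoint (append_mat_cols F1 F2) =
      four_block_mat (mat_adjoint F1) (0\<^sub>m f1 0) (mat_adjoint F2) (0\<^sub>m f2 0)"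
    by (rule eq_matI) (use F in \<open>auto simp: append_mat_cols_def\<close>)
  have TG: "T * append_mat_cols G1 G2 = four_block_mat (T * G1) (T * G2) (0\<^sub>m 0 g1) (0\<^sub>m 0 g2)"
  proof -
    \<comment> \<open>Padding T with empty blocks gives it the block shape of the appended
      columns.\<close>
    have TT: "T = four_block_mat T (0\<^sub>m n 0) (0\<^sub>m 0 m) (0\<^sub>m 0 0)"
      by (rule eq_matI) (use T in auto)
    show ?thesis unfolding append_mat_cols_def
      by (subst TT, subst mult_four_block_mat[of _ n m _ 0 _ 0 _ _ g1 _ g2])
         (use G T in \<open>auto intro!: cong_four_block_mat\<close>)
  qed
  have F': "mat_adjoint F1 \<in> carrier_mat f1 n" "mat_adjoint F2 \<in> carrier_mat f2 n"
    using F by (auto intro!: carrier_matI)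
  show ?thesis unfolding adj TG
    by (subst mult_four_block_mat[of _ f1 n _ 0 _ f2 _ _ g1 _ g2])
       (use F' G T in \<open>auto intro!: cong_four_block_mat\<close>)
qed

lemma append_mat_cols_mult_adjoint:
  fixes F1 :: "complex mat"
  assumes "F1 \<in> carrier_mat n k" "F2 \<in> carrier_mat n l"
  shows "append_mat_cols F1 F2 * mat_adjoint (append_mat_cols F1 F2) =
    F1 * mat_adjoint F1 + F2 * mat_adjoint F2"
proof -
  have adj: "mat_adjoint (append_mat_cols F1 F2) =
      four_block_mat (mat_adjoint F1) (0\<^sub>m k 0) (mat_adjoint F2) (0\<^sub>m l 0)"
    by (rule eq_matI) (use assms in \<open>auto simp: append_mat_cols_def\<close>)
  have F': "mat_adjoint F1 \<in> carrier_mat k n" "mat_adjoint F2 \<in> carrier_mat l n"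
    using assms by (auto intro!: carrier_matI)
  have "append_mat_cols F1 F2 * mat_adjoint (append_mat_cols F1 F2) =
    four_block_mat (F1 * mat_adjoint F1 + F2 * mat_adjoint F2) (0\<^sub>m n 0) (0\<^sub>m 0 n) (0\<^sub>m 0 0)"
    unfolding adj unfolding append_mat_cols_def
    by (subst mult_four_block_mat[of _ n k _ l _ 0 _ _ n _ 0])
       (use assms F' in \<open>auto intro!: cong_four_block_mat\<close>)
  also have "\<dots> = F1 * mat_adjoint F1 + F2 * mat_adjoint F2"
    by (rule eq_matI) (use assms in auto)
  finally show ?thesis .
qed

subsection \<open>Bases of the kernel and its complement\<close>

lemma inner_mult_mat_vec:
  fixes M :: "complex mat"
  assumes M: "M \<in> carrier_mat m n" and v: "v \<in> carrier_vec m" and x: "x \<in> carrier_vec n"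
  shows "v \<bullet>c (M *\<^sub>v x) = (mat_adjoint M *\<^sub>v v) \<bullet>c x"
proof -
  have "v \<bullet>c (M *\<^sub>v x) = (\<Sum>i<m. \<Sum>j<n. v $ i * cnj (M $$ (i, j)) * cnj (x $ j))"
    using M v x by (simp add: scalar_prod_def atLeast0LessThan sum_distrib_left mult.assoc)
  also have "\<dots> = (\<Sum>j<n. \<Sum>i<m. v $ i * cnj (M $$ (i, j)) * cnj (x $ j))"
    by (rule sum.swap)
  also have "\<dots> = (mat_adjoint M *\<^sub>v v) \<bullet>c x"
    using M v x by (simp add: scalar_prod_def atLeast0LessThan sum_distrib_left sum_distrib_right mult_ac)
  finally show ?thesis .
qed

text \<open>A vector v orthogonal to im M is in particular orthogonal to M M* v, which says that M*
  v has norm 0.\<close>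

lemma ortho_compl_im_mat:
  assumes M: "M \<in> carrier_mat n m"
  shows "ortho_compl n (im_mat M) = mat_kernel (mat_adjoint M)"
proof -
  have c: "mat_adjoint M *\<^sub>v v \<in> carrier_vec m" for v using M by (auto intro!: carrier_vecI)
  have "mat_adjoint M *\<^sub>v v = 0\<^sub>v m"
    if v: "v \<in> carrier_vec n" and o: "\<forall>x \<in> carrier_vec m. v \<bullet>c (M *\<^sub>v x) = 0" for v
  proof -
    have "(mat_adjoint M *\<^sub>v v) \<bullet>c (mat_adjoint M *\<^sub>v v) = 0"
      using o c[of v] by (subst inner_mult_mat_vec[OF M v c, symmetric]) blast
    thus ?thesis using conjugate_square_eq_0_vec[OF c[of v]] by simp
  qed
  moreover have "v \<bullet>c (M *\<^sub>v x) = 0"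
    if "v \<in> carrier_vec n" "x \<in> carrier_vec m" "mat_adjoint M *\<^sub>v v = 0\<^sub>v m" for v x
    unfolding inner_mult_mat_vec[OF M that(1,2)] that(3) using that by simp
  ultimately show ?thesis
    using M by (auto simp: ortho_compl_def im_mat_eq mat_kernel_def) blast
qed

text \<open>The last two conclusions together say V V* = M^+ M. The first of them holds because the
  columns of M* are orthogonal to ker M.\<close>

lemma ortho_kernel_basis:
  assumes M: "M \<in> carrier_mat n n"
    and V: "orthonormal_basis_mat n (ortho_compl n (mat_kernel M)) V"
  shows "dim_row V = n" "mat_adjoint V * V = 1\<^sub>m (dim_col V)"
    "M * (V * mat_adjoint V) = M" "mp_inverse M * (M * V) = V"
proof -
  define N where "N = mp_inverse M"
  have d: "dim_row M = n" "dim_col M = n" "dim_row N = n" "dim_col N = n" using M by (auto simp: N_def)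
  have "mat_kernel M \<subseteq> carrier_vec n" using d by (auto simp: mat_kernel_def)
  note V' = orthonormal_basis_matD[OF V submodule_ortho_compl[OF this]]
  show dV: "dim_row V = n" and "mat_adjoint V * V = 1\<^sub>m (dim_col V)" by (rule V'(1), rule V'(2))
  note rw = mult_assoc_dim mult_minus_dim minus_mult_dim mat_adjoint_mult mat_adjoint_minus d dV
  have "V * (mat_adjoint V * mat_adjoint M) = mat_adjoint M"
  proof (rule V'(4))
    fix j assume j: "j < dim_col (mat_adjoint M)"
    have e: "col (mat_adjoint M) j = mat_adjoint M *\<^sub>v col (1\<^sub>m n) j"
      using col_mult_dim[of "mat_adjoint M" "1\<^sub>m n" j] j d by simp
    have c: "col (1\<^sub>m n) j \<in> carrier_vec n" by (rule carrier_vecI) simp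
    have "col (mat_adjoint M) j \<bullet>c w = 0" if w: "w \<in> carrier_vec n" "M *\<^sub>v w = 0\<^sub>v n" for w
      unfolding e inner_mult_mat_vec[OF M c w(1), symmetric] w(2) by (simp add: scalar_prod_def)
    moreover have "col (mat_adjoint M) j \<in> carrier_vec n" by (rule carrier_vecI) (simp add: d)
    ultimately show "col (mat_adjoint M) j \<in> ortho_compl n (mat_kernel M)"
      by (simp add: ortho_compl_def mat_kernel_def d)
  qed (simp add: d)
  from arg_cong[OF this, of mat_adjoint] show "M * (V * mat_adjoint V) = M" by (simp add: rw)
  \<comment> \<open>F is the orthogonal projection onto ker M. Its columns are orthogonal to those
    of V, and F* = F turns F* V = 0 into F V = 0.\<close>
  define F where "F = 1\<^sub>m n - N * M"
  have dF: "dim_row F = n" "dim_col F = n" by (auto simp: F_def d)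
  have MF: "M * F = 0\<^sub>m n n"
    by (simp add: F_def rw N_def mp_inverse_props minus_self_mat)
  have "mat_adjoint F * V = 0\<^sub>m n (dim_col V)"
  proof (rule eq_matI)
    fix i j assume "i < dim_row (0\<^sub>m n (dim_col V) :: complex mat)" "j < dim_col (0\<^sub>m n (dim_col V) :: complex mat)"
    hence ij: "i < n" "j < dim_col V" by auto
    have "col F i \<in> mat_kernel M"
      by (rule col_in_mat_kernelI) (use MF ij dF d in auto)
    moreover have "col V j \<in> ortho_compl n (mat_kernel M)" by (rule V'(3)[OF ij(2)])
    ultimately show "(mat_adjoint F * V) $$ (i, j) = 0\<^sub>m n (dim_col V) $$ (i, j)"
      using ij dF dV by (simp add: mat_adjoint_mult_index ortho_compl_def del: index_mult_mat)
  qed (auto simp: dF dV)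
  moreover have "mat_adjoint (N * M) = N * M" unfolding N_def by (rule mp_inverse_props)
  hence "mat_adjoint F = F" unfolding F_def by (subst mat_adjoint_minus) (auto simp: d)
  ultimately have "F * V = 0\<^sub>m n (dim_col V)" by simp
  hence "V - N * (M * V) = 0\<^sub>m n (dim_col V)" by (simp add: F_def rw)
  hence "V = N * (M * V)" by (rule minus_eq_zero_matD) (auto simp: d dV)
  thus "mp_inverse M * (M * V) = V" unfolding N_def by simp
qed

text \<open>V and \<open>a\<close> together form an orthonormal basis of im A, since M P = M with P
  = A B places the complement of ker M inside im A. The lemma is applied to M and to M*.\<close>

lemma kernel_Int_im_basis:
  assumes M: "M \<in> carrier_mat n n" and A: "A \<in> carrier_mat n n" and B: "B \<in> carrier_mat n n"
    and MP: "M * (A * B) = M" and ABA: "A * (B * A) = A" and herm: "mat_adjoint (A * B) = A * B"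
    and V: "orthonormal_basis_mat n (ortho_compl n (mat_kernel M)) V"
    and a: "orthonormal_basis_mat n (mat_kernel M \<inter> im_mat A) a"
  shows "dim_row a = n" "mat_adjoint a * a = 1\<^sub>m (dim_col a)" "mat_adjoint V * a = 0\<^sub>m (dim_col V) (dim_col a)"
    "V * mat_adjoint V + a * mat_adjoint a = A * B"
proof -
  define N where "N = mp_inverse M"
  define P where "P = A * B"
  note V' = ortho_kernel_basis[OF M V, folded N_def]
  note a' = orthonormal_basis_matD[OF a submodule_Int[OF submodule_mat_kernel[OF M] submodule_im_mat[OF A]]]
  show da: "dim_row a = n" and aa: "mat_adjoint a * a = 1\<^sub>m (dim_col a)" by (rule a'(1), rule a'(2))
  have d: "dim_row M = n" "dim_col M = n" "dim_row N = n" "dim_col N = n" "dim_row A = n" "dim_col A = n"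
    "dim_row B = n" "dim_col B = n" "dim_row P = n" "dim_col P = n"
    using M A B by (auto simp: N_def P_def)
  note rw = mult_assoc_dim mult_minus_dim minus_mult_dim mat_adjoint_mult mat_adjoint_minus d da V'(1)
  have NM: "mat_adjoint (N * M) = N * M" unfolding N_def by (rule mp_inverse_props)
  have MP': "M * P = M" "mat_adjoint P = P" "P * A = A" using MP ABA herm by (simp_all add: P_def rw)
  have "M * a = 0\<^sub>m (dim_row M) (dim_col a)"
    by (rule mult_eq_zero_colsI) (use a'(3) d da in auto)
  hence Ma: "M * a = 0\<^sub>m n (dim_col a)" by (simp add: d)
  obtain Z where Z: "Z \<in> carrier_mat n (dim_col a)" "a = A * Z"
    using factor_through_im_mat[of a A] a'(3) d da by auto
  have Pa: "P * a = a" unfolding Z(2) using mult_left_cong[OF MP'(3), of Z] Z(1) d by simp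
  \<comment> \<open>Because N M is Hermitian, N M V = V exhibits V as a left multiple by M*; hence V
    is orthogonal to ker M and fixed by P.\<close>
  have V2: "V = mat_adjoint M * (mat_adjoint N * V)"
  proof -
    have "V = mat_adjoint (N * M) * V" unfolding NM using V'(4) by (simp add: rw)
    thus ?thesis by (simp add: rw)
  qed
  have "mat_adjoint V * a = mat_adjoint V * (N * (M * a))"
    by (subst V2) (simp add: rw)
  thus Va: "mat_adjoint V * a = 0\<^sub>m (dim_col V) (dim_col a)"
    unfolding Ma by (simp add: rw)
  have aV: "mat_adjoint a * V = 0\<^sub>m (dim_col a) (dim_col V)"
    using arg_cong[OF Va, of mat_adjoint] by (simp add: rw)
  have PM: "P * mat_adjoint M = mat_adjoint M"
    using arg_cong[OF MP'(1), of mat_adjoint] MP'(2) by (simp add: rw)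
  have PV: "P * V = V"
    by (subst (1 2) V2) (use mult_left_cong[OF PM, of "mat_adjoint N * V"] in \<open>simp add: rw\<close>)
  have PP: "P * P = P"
    using mult_left_cong[OF MP'(3), of B] by (simp add: P_def rw)
  have aP: "mat_adjoint a * P = mat_adjoint a"
    using arg_cong[OF Pa, of mat_adjoint] MP'(2) by (simp add: rw)
  \<comment> \<open>D should be the projection onto the intersection of ker M and im A. Its columns
    lie there, so a a* D = D, while a* D = a*; therefore D = a a*.\<close>
  define D where "D = P - V * mat_adjoint V"
  have dD: "dim_row D = n" "dim_col D = n" by (auto simp: D_def rw)
  have MD: "M * D = 0\<^sub>m n n" by (simp add: D_def rw MP' V' minus_self_mat)
  have PD: "P * D = D"
    using mult_left_cong[OF PV, of "mat_adjoint V"] by (simp add: D_def rw PP)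
  have "a * (mat_adjoint a * D) = D"
  proof (rule a'(4))
    fix j assume j: "j < dim_col D"
    have "col D j \<in> mat_kernel M"
      by (rule col_in_mat_kernelI) (use MD j dD d in auto)
    moreover have "col D j = A *\<^sub>v col (B * D) j"
      using col_mult_dim[of A "B * D" j] PD j by (simp add: P_def rw dD)
    hence "col D j \<in> im_mat A"
      unfolding im_mat_eq using d j dD by (auto intro!: carrier_vecI exI[of _ "col (B * D) j"])
    ultimately show "col D j \<in> mat_kernel M \<inter> im_mat A" by simp
  qed (rule dD)
  moreover have "mat_adjoint a * D = mat_adjoint a"
    using mult_left_cong[OF aV, of "mat_adjoint V"] by (simp add: D_def rw aP)
  ultimately have "a * mat_adjoint a = P - V * mat_adjoint V" by (simp add: D_def)
  thus "V * mat_adjoint V + a * mat_adjoint a = A * B"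
    unfolding P_def[symmetric] by (intro eq_matI) (auto simp: d V'(1) simp del: index_mult_mat(1))
qed

subsection \<open>The determinantal formulas\<close>

text \<open>\<open>N\<close> stands for M^+, and the factorization through \<open>Z\<close> encodes
  index 1.\<close>

lemma pseudo_det_outer_inverse:
  assumes A: "A \<in> carrier_mat n n" and M: "M \<in> carrier_mat n n" and N: "N \<in> carrier_mat n n"
    and V: "V \<in> carrier_mat n r" and W: "W \<in> carrier_mat n s"
    and MAM: "M * (A * M) = M" and ind: "Z \<in> carrier_mat n n" "M = M * M * Z"
    and VV: "mat_adjoint V * V = 1\<^sub>m r" and WW: "mat_adjoint W * W = 1\<^sub>m s"
    and MVV: "M * (V * mat_adjoint V) = M" and WWM: "W * (mat_adjoint W * M) = M"
    and NMV: "N * (M * V) = V" and MNW: "M * (N * W) = W"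
  shows "r = s" "det (mat_adjoint V * W) \<noteq> 0" "det (mat_adjoint V * (A * W)) \<noteq> 0"
    "pseudo_det M = det (mat_adjoint V * W) / det (mat_adjoint V * (A * W))"
proof -
  have d: "dim_row A = n" "dim_col A = n" "dim_row M = n" "dim_col M = n" "dim_row N = n" "dim_col N = n"
    "dim_row V = n" "dim_col V = r" "dim_row W = n" "dim_col W = s" "dim_row Z = n" "dim_col Z = n"
    using A M N V W ind(1) by auto
  \<comment> \<open>M = W C V* with C invertible, and M A M = M says that V* A W is the inverse of C.\<close>
  define C C' where "C = mat_adjoint W * (M * V)" and "C' = mat_adjoint V * (N * W)"
  have C: "C \<in> carrier_mat s r" "C' \<in> carrier_mat r s" by (auto simp: C_def C'_def d intro!: carrier_matI)
  have dC: "dim_row C = s" "dim_col C = r" "dim_row C' = r" "dim_col C' = s" using C by auto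
  note rw = mult_assoc_dim d dC
  note WWM' = mult_left_cong3[OF WWM, simplified d dim_mat_adjoint, OF refl refl]
  note MVV' = mult_left_cong3[OF MVV, simplified d dim_mat_adjoint, OF refl refl]
  have C'C: "C' * C = 1\<^sub>m r" by (simp add: C_def C'_def rw WWM' NMV VV)
  have CC': "C * C' = 1\<^sub>m s" by (simp add: C_def C'_def rw MVV' MNW WW)
  show rs: "r = s" using mult_one_dims_eq[OF C(2,1) C'C CC'] .
  define K L where "K = mat_adjoint V * W" and "L = mat_adjoint V * (A * W)"
  have c: "C \<in> carrier_mat r r" "K \<in> carrier_mat r r" "L \<in> carrier_mat r r"
    by (auto simp: K_def L_def d C rs intro!: carrier_matI simp: dC)
  have WCV: "W * (C * mat_adjoint V) = M" by (simp add: C_def rw WWM' WWM MVV)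
  have dKL: "dim_row K = r" "dim_col K = s" "dim_row L = r" "dim_col L = s" by (auto simp: K_def L_def d)
  have CLC: "C * (L * C) = C"
  proof -
    have "C * (L * C) = mat_adjoint W * (M * (A * (M * V)))"
      by (simp add: C_def L_def rw WWM' MVV')
    also have "M * (A * (M * V)) = M * V"
      using mult_left_cong3[OF MAM, of V] by (simp add: d)
    finally show ?thesis by (simp add: C_def)
  qed
  have "L * C = C' * (C * (L * C))" using mult_left_cong[OF C'C, of "L * C"] by (simp add: dC dKL)
  hence LC: "L * C = 1\<^sub>m r" unfolding CLC C'C .
  have detL: "det L * det C = 1" using det_mult[OF c(3,1)] LC by simp
  \<comment> \<open>M = M M Z gives C K E = C for K = V* W; cancelling det C, which is nonzero,
    yields det K det E = 1.\<close>
  define E where "E = mat_adjoint W * (M * (Z * V))"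
  have E: "E \<in> carrier_mat r r" using rs by (auto simp: E_def d intro!: carrier_matI)
  have "C * (K * E) = mat_adjoint W * (M * (M * (Z * V)))"
    by (simp add: C_def K_def E_def rw WWM' MVV')
  also have "M * (M * (Z * V)) = M * V"
    using arg_cong[OF ind(2), of "\<lambda>T. T * V"] by (simp add: rw)
  finally have "C * (K * E) = C" by (simp add: C_def)
  hence "det C * (det K * det E) = det C"
    using det_mult[OF c(1), of "K * E"] det_mult[OF c(2) E] c E by simp
  hence detK: "det K \<noteq> 0" using detL by auto
  have "pseudo_det (W * (C * mat_adjoint V)) = det (C * mat_adjoint V * W)"
    by (rule pseudo_det_mult[of _ n r])
       (use rs detK detL det_mult[OF c(1,2)] in \<open>auto simp: rw K_def[symmetric] intro!: carrier_matI\<close>)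
  hence pd: "pseudo_det M = det C * det K"
    unfolding WCV using det_mult[OF c(1,2)] by (simp add: rw K_def)
  show "det (mat_adjoint V * W) \<noteq> 0" "det (mat_adjoint V * (A * W)) \<noteq> 0"
    "pseudo_det M = det (mat_adjoint V * W) / det (mat_adjoint V * (A * W))"
    unfolding K_def[symmetric] L_def[symmetric] using detK detL pd
    by (auto simp: eq_divide_eq mult.assoc mult.left_commute[of _ "det L"] mult.commute[of _ "det L"])
qed

text \<open>The number \<open>q\<close> is the determinant of U1* U2, the change between the two
  orthonormal bases of im A. Sharing it between both identities lets it cancel afterwards.\<close>

lemma complementary_minors:
  assumes A: "A \<in> carrier_mat n n" and B: "B \<in> carrier_mat n n"
    and V: "V \<in> carrier_mat n r" and W: "W \<in> carrier_mat n r"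
    and a: "a \<in> carrier_mat n k" and b: "b \<in> carrier_mat n l"
    and ABA: "A * (B * A) = A" and comm: "B * A = A * B"
    and VV: "mat_adjoint V * V = 1\<^sub>m r" and WW: "mat_adjoint W * W = 1\<^sub>m r"
    and aa: "mat_adjoint a * a = 1\<^sub>m k" and bb: "mat_adjoint b * b = 1\<^sub>m l"
    and Va: "mat_adjoint V * a = 0\<^sub>m r k" and Wb: "mat_adjoint W * b = 0\<^sub>m r l"
    and P1: "V * mat_adjoint V + a * mat_adjoint a = A * B"
    and P2: "W * mat_adjoint W + b * mat_adjoint b = A * B"
  obtains q where "k = l" "q \<noteq> 0"
    "pseudo_det A * q * det (mat_adjoint b * (B * a)) = det (mat_adjoint V * (A * W))"
    "q * det (mat_adjoint b * a) = det (mat_adjoint V * W)"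
    "pseudo_det A \<noteq> 0"
proof -
  define U1 U2 where "U1 = append_mat_cols V a" and "U2 = append_mat_cols W b"
  define P where "P = A * B"
  have U: "U1 \<in> carrier_mat n (r + k)" "U2 \<in> carrier_mat n (r + l)"
    using V W a b by (auto simp: U1_def U2_def intro!: carrier_matI)
  have d: "dim_row A = n" "dim_col A = n" "dim_row B = n" "dim_col B = n" "dim_row P = n" "dim_col P = n"
    "dim_row U1 = n" "dim_col U1 = r + k" "dim_row U2 = n" "dim_col U2 = r + l"
    using A B U by (auto simp: P_def)
  note rw = mult_assoc_dim d
  have UU: "U1 * mat_adjoint U1 = P" "U2 * mat_adjoint U2 = P"
    unfolding U1_def U2_def P_def by (simp_all add: append_mat_cols_mult_adjoint[OF V a]
      append_mat_cols_mult_adjoint[OF W b] P1 P2)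
  note sandwich = append_mat_cols_sandwich[OF V a V a one_carrier_mat, folded U1_def]
    append_mat_cols_sandwich[OF W b W b one_carrier_mat, folded U2_def]
  have aV: "mat_adjoint a * V = 0\<^sub>m k r"
    using arg_cong[OF Va, of mat_adjoint] V a by (simp add: mat_adjoint_mult)
  have bW: "mat_adjoint b * W = 0\<^sub>m l r"
    using arg_cong[OF Wb, of mat_adjoint] W b by (simp add: mat_adjoint_mult)
  have I: "mat_adjoint U1 * U1 = 1\<^sub>m (r + k)" "mat_adjoint U2 * U2 = 1\<^sub>m (r + l)"
    using sandwich V W a b by (simp_all add: d VV WW aa bb Va Wb aV bW)
  have PA: "P * A = A" "A * P = A" using ABA comm by (simp_all add: P_def rw)
  note c1 = mult_left_cong[OF UU(1), simplified d dim_mat_adjoint, OF refl]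
  note c2 = mult_left_cong[OF UU(2), simplified d dim_mat_adjoint, OF refl]
  have PU: "P * U1 = U1" "P * U2 = U2" using c1[of U1] c2[of U2] I by (simp_all add: d)
  have AP: "A * (P * Z) = A * Z" "A * (B * Z) = P * Z" if "dim_row Z = n" for Z
    using mult_left_cong[OF PA(2), of Z] that by (simp_all add: d P_def mult_assoc_dim)
  define Q where "Q = mat_adjoint U1 * U2"
  have QQ: "Q * (mat_adjoint U2 * U1) = 1\<^sub>m (r + k)"
    by (simp add: Q_def rw c2 PU I)
  have QQ': "mat_adjoint U2 * U1 * Q = 1\<^sub>m (r + l)"
    by (simp add: Q_def rw c1 PU I)
  have "r + k = r + l"
    by (rule mult_one_dims_eq[OF _ _ QQ QQ']) (auto simp: Q_def d intro!: carrier_matI)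
  hence kl: "k = l" by simp
  define A0 where "A0 = mat_adjoint U1 * (A * U1)"
  have "A0 * (mat_adjoint U1 * (B * U1)) = 1\<^sub>m (r + k)"
    by (simp add: A0_def rw c1 AP PU I)
  hence A0: "det A0 * det (mat_adjoint U1 * (B * U1)) = 1"
    by (subst det_mult[symmetric, of _ "r + k"]) (auto simp: A0_def d intro!: carrier_matI)
  \<comment> \<open>A = P A = U1 (U1* A), and exchanging the two factors leaves the compression U1*
    A U1.\<close>
  have pdA: "pseudo_det A = det A0"
  proof -
    have "pseudo_det (U1 * (mat_adjoint U1 * A)) = det (mat_adjoint U1 * A * U1)"
      by (rule pseudo_det_mult[of _ n "r + k"])
         (use A0 in \<open>auto simp: rw A0_def[symmetric] intro!: carrier_matI\<close>)
    thus ?thesis by (simp add: rw c1 PA A0_def)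
  qed
  have cQ: "Q \<in> carrier_mat (r + k) (r + k)" "A0 \<in> carrier_mat (r + k) (r + k)"
    by (auto simp: Q_def A0_def d kl intro!: carrier_matI)
  have G: "mat_adjoint U1 * (A * U2) = A0 * Q"
    by (simp add: A0_def Q_def rw c1 AP)
  have detG: "det (mat_adjoint U1 * (A * U2)) = det A0 * det Q"
    unfolding G by (rule det_mult[OF cQ(2,1)])
  have detQ: "det Q * det (mat_adjoint U2 * U1) = 1"
    using QQ by (subst det_mult[symmetric, of _ "r + k"]) (use cQ kl in \<open>auto simp: d intro!: carrier_matI\<close>)
  have GH: "mat_adjoint U1 * (A * U2) * (mat_adjoint U2 * (B * U1)) = 1\<^sub>m (r + k)"
    by (simp add: rw c2 AP PU I)
  note blk = append_mat_cols_sandwich[OF V a W b, folded U1_def U2_def]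
    append_mat_cols_sandwich[OF W b V a, folded U1_def U2_def]
  have car: "mat_adjoint E * (T * F) \<in> carrier_mat e f"
    if "E \<in> carrier_mat n e" "T \<in> carrier_mat n n" "F \<in> carrier_mat n f" for E T F :: "complex mat" and e f
    using that by (auto intro!: carrier_matI)
  have b': "b \<in> carrier_mat n k" using b kl by simp
  have 1: "det A0 * det Q * det (mat_adjoint b * (B * a)) = det (mat_adjoint V * (A * W))"
    unfolding detG[symmetric] using GH unfolding blk(1)[OF A] blk(2)[OF B]
    by (intro det_block_inverse[of _ r _ k]) (auto intro!: car A B V W a b')
  \<comment> \<open>The identity matrix can stand for P here, since P fixes U1 and U2.\<close>
  have GH': "mat_adjoint U1 * (1\<^sub>m n * U2) * (mat_adjoint U2 * (1\<^sub>m n * U1)) = 1\<^sub>m (r + k)"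
    using QQ by (simp add: Q_def d)
  have Q': "Q = mat_adjoint U1 * (1\<^sub>m n * U2)" by (simp add: Q_def d)
  have "det Q * det (mat_adjoint b * (1\<^sub>m n * a)) = det (mat_adjoint V * (1\<^sub>m n * W))"
    unfolding Q' using GH' unfolding blk(1)[OF one_carrier_mat] blk(2)[OF one_carrier_mat]
    by (intro det_block_inverse[of _ r _ k]) (auto intro!: car V W a b')
  hence 2: "det Q * det (mat_adjoint b * a) = det (mat_adjoint V * W)" using a W by simp
  show thesis
    by (rule that[of "det Q"]) (use kl detQ 1 2 pdA A0 in auto)
qed

text \<open>A A^+ and A^+ A are the orthogonal projections onto im A and im A*. Equal images make
  each absorb the other from the left; as both are Hermitian, taking adjoints shows that they
  coincide.\<close>

lemma EP_mat_commute:
  assumes A: "A \<in> carrier_mat n n" and EP: "EP_mat A"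
  shows "mp_inverse A * A = A * mp_inverse A"
proof -
  define B where "B = mp_inverse A"
  have d: "dim_row A = n" "dim_col A = n" "dim_row B = n" "dim_col B = n" using A by (auto simp: B_def)
  note mp = mp_inverse_props[of A, folded B_def]
  have im: "im_mat A = im_mat (mat_adjoint A)" using EP by (simp add: EP_mat_def)
  obtain Z where Z: "Z \<in> carrier_mat n n" "A = mat_adjoint A * Z"
    using im_mat_subset_factor[of A "mat_adjoint A"] im d by auto
  obtain Z' where Z': "Z' \<in> carrier_mat n n" "mat_adjoint A = A * Z'"
    using im_mat_subset_factor[of "mat_adjoint A" A] im d by auto
  note rw = mult_assoc_dim mat_adjoint_mult d Z(1)[THEN carrier_matD(1)] Z(1)[THEN carrier_matD(2)]
    Z'(1)[THEN carrier_matD(1)] Z'(1)[THEN carrier_matD(2)]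
  have "B * A * mat_adjoint A = mat_adjoint (A * (B * A))"
    using mp(4) by (subst mat_adjoint_mult) (simp_all add: d)
  hence BAA: "B * A * mat_adjoint A = mat_adjoint A" by (simp only: mp(1))
  have "B * A * A = B * A * (mat_adjoint A * Z)" by (simp only: Z(2)[symmetric])
  also have "\<dots> = A" using mult_left_cong[OF BAA, of Z] Z(2) by (simp add: rw)
  finally have 1: "B * A * A = A" .
  have "A * B * mat_adjoint A = A * B * (A * Z')" by (simp only: Z'(2)[symmetric])
  also have "\<dots> = mat_adjoint A"
    using mult_left_cong3[OF mp(1), of Z'] Z'(2) by (simp add: rw)
  finally have 2: "A * B * mat_adjoint A = mat_adjoint A" .
  have "A * B * (B * A) = A * B * (mat_adjoint A * mat_adjoint B)"
    using mp(4) by (simp add: mat_adjoint_mult d)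
  also have "\<dots> = mat_adjoint A * mat_adjoint B"
    using mult_left_cong[OF 2, of "mat_adjoint B"] by (simp add: d)
  also have "\<dots> = B * A" using mp(4) by (simp add: mat_adjoint_mult d)
  finally have 3: "A * B * (B * A) = B * A" .
  have "A * B = B * A * (A * B)"
    using mult_left_cong[OF 1, of B] by (simp add: d)
  also have "\<dots> = mat_adjoint (A * B * (B * A))"
    using mp(3,4) by (subst mat_adjoint_mult) (simp_all add: d)
  also have "\<dots> = B * A" unfolding 3 by (rule mp(4))
  finally show ?thesis by (simp add: B_def)
qed

theorem mainTheorem4:
  fixes A X Y M U_XA U_YA U_Xp U_Yp :: "complex mat"
    and n p q :: nat
    and im_A Xh Yh XhA YhA :: "complex vec set"
  assumes "A \<in> carrier_mat n n" and "EP_mat A"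
    and "X \<in> carrier_mat n p" and "Y \<in> carrier_mat n q"
    and "M = mp_inverse A - mp_inverse A * X * mp_inverse (mat_adjoint Y * mp_inverse A * X)
               * mat_adjoint Y * mp_inverse A"
    and "im_A = im_mat A"
    and "Xh = mat_kernel M" and "Yh = ortho_compl n (im_mat M)"
    and "XhA = Xh \<inter> im_A" and "YhA = Yh \<inter> im_A"
    and "mat_index M = 1"
    and "orthonormal_basis_mat n XhA U_XA"
    and "orthonormal_basis_mat n YhA U_YA"
    and "orthonormal_basis_mat n (ortho_compl n Xh) U_Xp"
    and "orthonormal_basis_mat n (ortho_compl n Yh) U_Yp"
  shows "invertible_mat (mat_adjoint U_Xp * U_Yp) \<and>
         invertible_mat (mat_adjoint U_Xp * A * U_Yp) \<and>
         invertible_mat (mat_adjoint U_YA * U_XA) \<and>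
         invertible_mat (mat_adjoint U_YA * mp_inverse A * U_XA) \<and>
         pseudo_det M = det (mat_adjoint U_Xp * U_Yp) / det (mat_adjoint U_Xp * A * U_Yp) \<and>
         pseudo_det M = det (mat_adjoint U_YA * U_XA)
           / (pseudo_det A * det (mat_adjoint U_YA * mp_inverse A * U_XA))"
proof -
  note A = assms(1) and X = assms(3) and Y = assms(4) and M_def = assms(5)
  define B where "B = mp_inverse A"
  define S where "S = mp_inverse (mat_adjoint Y * B * X)"
  define T where "T = X * (S * mat_adjoint Y)"
  have d: "dim_row A = n" "dim_col A = n" "dim_row B = n" "dim_col B = n"
    "dim_row X = n" "dim_col X = p" "dim_row Y = n" "dim_col Y = q"
    "dim_row S = p" "dim_col S = q" "dim_row T = n" "dim_col T = n"
    using A X Y by (auto simp: B_def S_def T_def)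
  note rw = mult_assoc_dim mult_minus_dim minus_mult_dim mat_adjoint_mult mat_adjoint_minus d
  have M_eq: "M = B - B * (T * B)"
    unfolding M_def B_def[symmetric] S_def[symmetric] T_def by (simp add: rw)
  have M: "M \<in> carrier_mat n n" and B: "B \<in> carrier_mat n n"
    by (auto simp: M_eq d intro!: carrier_matI)
  have dM: "dim_row M = n" "dim_col M = n" using M by auto
  note mp = mp_inverse_props[of A, folded B_def]
  have comm: "B * A = A * B" unfolding B_def by (rule EP_mat_commute[OF A assms(2)])
  have BAB: "B * (A * B) = B" by (rule mp(2))
  have BABZ: "B * (A * (B * Z)) = B * Z" if "dim_row Z = n" for Z
    using mult_left_cong3[OF BAB, of Z] that by (simp add: d)
  \<comment> \<open>Commutation is used here: P also fixes the image of A^+, which gives P M = M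
    below.\<close>
  have ABB: "A * (B * B) = B" using BAB mult_left_cong[OF comm, of B] by (simp add: rw)
  have ABBZ: "A * (B * (B * Z)) = B * Z" if "dim_row Z = n" for Z
    using mult_left_cong3[OF ABB, of Z] that by (simp add: d)
  have SS: "S * (mat_adjoint Y * (B * (X * S))) = S"
    using mp_inverse_props(2)[of "mat_adjoint Y * B * X", folded S_def] by (simp add: rw)
  have TBT: "T * (B * T) = T"
  proof -
    have "T * (B * T) = X * (S * (mat_adjoint Y * (B * (X * S))) * mat_adjoint Y)"
      by (simp add: T_def rw)
    thus ?thesis unfolding SS T_def .
  qed
  have TBT': "T * (B * (T * Z)) = T * Z" if "dim_row Z = n" for Z
    using mult_left_cong3[OF TBT, of Z] that by (simp add: d)
  have MAM: "M * (A * M) = M"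
    unfolding M_eq by (simp add: rw BAB BABZ TBT' minus_self_mat)
  have MP: "M * (A * B) = M" unfolding M_eq by (simp add: rw BAB)
  have PM: "A * (B * M) = M" unfolding M_eq by (simp add: rw ABB ABBZ)
  \<comment> \<open>The adjoint of P M = M is M* P = M*, the condition under which the kernel lemma
    applies to M*.\<close>
  have "mat_adjoint (A * (B * M)) = mat_adjoint M * mat_adjoint (A * B)"
    by (simp add: mat_adjoint_mult mult_assoc_dim d dM)
  hence MP': "mat_adjoint M * (A * B) = mat_adjoint M" unfolding PM mp(3) by simp
  have M': "mat_adjoint M \<in> carrier_mat n n" by (auto simp: dM intro!: carrier_matI)
  define V W a b where "V = U_Xp" and "W = U_Yp" and "a = U_XA" and "b = U_YA"
  note W_set = ortho_compl_im_mat[OF M]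
  have bas: "orthonormal_basis_mat n (ortho_compl n (mat_kernel M)) V"
    "orthonormal_basis_mat n (mat_kernel M \<inter> im_mat A) a"
    "orthonormal_basis_mat n (ortho_compl n (mat_kernel (mat_adjoint M))) W"
    "orthonormal_basis_mat n (mat_kernel (mat_adjoint M) \<inter> im_mat A) b"
    using assms(6-10,12-15) by (simp_all add: W_set V_def W_def a_def b_def)
  note V = ortho_kernel_basis[OF M bas(1)] and W = ortho_kernel_basis[OF M' bas(3)]
  note a = kernel_Int_im_basis[OF M A B MP mp(1) mp(3) bas(1,2)]
  note b = kernel_Int_im_basis[OF M' A B MP' mp(1) mp(3) bas(3,4)]
  define r s k l where "r = dim_col V" and "s = dim_col W" and "k = dim_col a" and "l = dim_col b"
  have dims: "V \<in> carrier_mat n r" "W \<in> carrier_mat n s" "a \<in> carrier_mat n k" "b \<in> carrier_mat n l"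
    using V(1) W(1) a(1) b(1) by (auto simp: r_def s_def k_def l_def)
  define N where "N = mp_inverse M"
  define N' where "N' = mp_inverse (mat_adjoint M)"
  have N: "N \<in> carrier_mat n n" by (auto simp: N_def dM intro!: carrier_matI)
  have dN: "dim_row N = n" "dim_col N = n" "dim_row N' = n" "dim_col N' = n" by (auto simp: N_def N'_def dM)
  note rw' = mult_assoc_dim mat_adjoint_mult dM dN V(1) W(1)
  have WWM: "W * (mat_adjoint W * M) = M"
    using arg_cong[OF W(3), of mat_adjoint] by (simp add: rw')
  have MNW: "M * (N * W) = W"
  proof -
    have "N' * mat_adjoint M = mat_adjoint (N' * mat_adjoint M)"
      unfolding N'_def by (rule mp_inverse_props(4)[symmetric])
    hence "N' * mat_adjoint M = M * mat_adjoint N'" by (simp add: rw')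
    hence WM: "W = M * (mat_adjoint N' * W)"
      using W(4)[folded N'_def] by (metis mult_assoc_dim dim_mat_adjoint dM dN W(1))
    have "M * (N * M) = M" unfolding N_def by (rule mp_inverse_props)
    hence "M * (N * (M * (mat_adjoint N' * W))) = M * (mat_adjoint N' * W)"
      using mult_left_cong3[of M N M M "mat_adjoint N' * W"] by (simp add: dM dN)
    thus ?thesis unfolding WM[symmetric] .
  qed
  obtain Z where Z: "Z \<in> carrier_mat n n" "M = M * M * Z"
    using index_1_factor[OF M assms(11)] by blast
  note first = pseudo_det_outer_inverse[OF A M N dims(1,2) MAM Z V(2)[folded r_def] W(2)[folded s_def]
    V(3) WWM V(4)[folded N_def] MNW]
  from first(1) have sr: "s = r" by simp
  obtain t where t: "k = l" "t \<noteq> 0"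
    "pseudo_det A * t * det (mat_adjoint b * (B * a)) = det (mat_adjoint V * (A * W))"
    "t * det (mat_adjoint b * a) = det (mat_adjoint V * W)" "pseudo_det A \<noteq> 0"
    by (rule complementary_minors[OF A B dims(1) dims(2)[unfolded sr] dims(3,4) mp(1) comm
      V(2)[folded r_def] W(2)[folded s_def, unfolded sr] a(2)[folded k_def] b(2)[folded l_def]
      a(3)[folded r_def k_def] b(3)[folded s_def l_def, unfolded sr] a(4) b(4)]) blast
  have assoc: "mat_adjoint V * A * W = mat_adjoint V * (A * W)" "mat_adjoint b * B * a = mat_adjoint b * (B * a)"
    by (simp_all add: mult_assoc_dim d V(1) W(1) a(1) b(1))
  have nz: "det (mat_adjoint b * a) \<noteq> 0" "det (mat_adjoint b * (B * a)) \<noteq> 0"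
    using t first(2,3) by auto
  have inv: "invertible_mat (mat_adjoint V * W)" "invertible_mat (mat_adjoint V * (A * W))"
    "invertible_mat (mat_adjoint b * a)" "invertible_mat (mat_adjoint b * (B * a))"
    using dims sr t(1) first(2,3) nz
    by (auto intro!: invertible_matI_det)
  have "pseudo_det M = det (mat_adjoint b * a) / (pseudo_det A * det (mat_adjoint b * (B * a)))"
    unfolding first(4) t(3,4)[symmetric] using t(2) by (simp add: mult.assoc mult.left_commute[of _ t])
  thus ?thesis
    using inv first(4) unfolding V_def[symmetric] W_def[symmetric] a_def[symmetric] b_def[symmetric] B_def[symmetric] assoc
    by blast
qed

end
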